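(* Let $k,d$ be non-negative integers, not both $0$, and let $S \subset \mathbb{Z}^k \times \mathbb{N}^d$ be a finite set which is centrally compressed in the $i$-th coordinate with respect to every $p \in \mathbb{Z}^{k-1}\times\mathbb{N}^d$, for each $1 \le i \le k$, and downward compressed in the $j$-th coordinate with respect to every $p \in \mathbb{Z}^k\times\mathbb{N}^{d-1}$, for each $k+1 \le j \le k+d$. Then $$|\partial S| = \sum_{I \subset \{1,2,\dots,k+d\}} 2^{|I \cap K|}\,|P_I(S)|,$$ where $K = \{1,2,\dots,k\}$.
   Context: $\mathbb{N} = \{x\in\mathbb{Z} : x \ge 0\}$. For $S \subset \mathbb{Z}^k\times\mathbb{N}^d$, $\partial S = \{x \in \mathbb{Z}^k\times\mathbb{N}^d : \|x-y\|_\infty \le 1 \text{ for some } y \in S\}$, where $\|x\|_\infty=\max_i|x_i|$. For a vector $p=(p_1,\dots,p_n)$ and a number $x$, $(p, x\to i) = (p_1,\dots,p_{i-1},x,p_i,\dots,p_n)$, i.e. $x$ is inserted as the $i$-th coordinate. For $1\le i\le k$ and $p\in\mathbb{Z}^{k-1}\times\mathbb{N}^d$, $S$ is centrally compressed in the $i$-th coordinate with respect to $p$ if $\{x\in\mathbb{Z} : (p,x\to i)\in S\}$ is either empty, or of the form $\{x\in\mathbb{Z}: -a\le x\le a\}$ for some $a\in\mathbb{N}$, or of the form $\{x\in\mathbb{Z}: -a\le x\le a+1\}$ for some $a\in\mathbb{N}$. For $k+1\le j\le k+d$ and $p\in\mathbb{Z}^k\times\mathbb{N}^{d-1}$, $S$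 is downward compressed in the $j$-th coordinate with respect to $p$ if $\{x\in\mathbb{N} : (p,x\to j)\in S\}$ is either empty or of the form $\{x: 0\le x\le a\}$ for some $a\in\mathbb{N}$. For $I\subset\{1,\dots,k+d\}$, $P_I(S)$ is the $(k+d-|I|)$-dimensional projection of $S$ obtained by deleting the coordinates in $I$ (when $I$ is the full index set and $S\neq\emptyset$, $P_I(S)$ is a single point, so $|P_I(S)|=1$). The sum is over all subsets $I$, including the empty set and the full set. *)

theory Defs
  imports Main
begin

text \<open>
  Points of $Z^k \times N^d$ are integer lists of length \<open>k + d\<close> whose last \<open>d\<close> entries are
  nonnegative. Coordinates are numbered from 0, so the \<open>Z\<close>-coordinates are those in \<open>{..<k}\<close>
  and the \<open>N\<close>-coordinates those in \<open>{k..<k + d}\<close>.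
\<close>

definition grid :: "nat \<Rightarrow> nat \<Rightarrow> int list set" where
  "grid k d = {x. length x = k + d \<and> (\<forall>j. k \<le> j \<and> j < k + d \<longrightarrow> 0 \<le> x ! j)}"

text \<open>Only meaningful for nonempty lists, i.e. in positive dimension.\<close>

definition linf_norm :: "int list \<Rightarrow> int" where
  "linf_norm x = Max ((\<lambda>i. \<bar>x ! i\<bar>) ` {..<length x})"

definition vec_diff :: "int list \<Rightarrow> int list \<Rightarrow> int list" where
  "vec_diff x y = map2 (-) x y"

text \<open>The neighbourhood of \<open>S\<close> within the grid; it contains \<open>S\<close> itself.\<close>

definition boundary :: "nat \<Rightarrow> nat \<Rightarrow> int list set \<Rightarrow> int list set" where
  "boundary k d S = {x \<in> grid k d. \<exists>y\<in>S. linf_norm (vec_diff x y) \<le> 1}"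

text \<open>\<open>insert_coord p x i\<close> is $(p, x \to i)$: afterwards \<open>x\<close> is the entry at index \<open>i\<close>.\<close>

definition insert_coord :: "int list \<Rightarrow> int \<Rightarrow> nat \<Rightarrow> int list" where
  "insert_coord p x i = take i p @ x # drop i p"

definition centrally_compressed :: "int list set \<Rightarrow> nat \<Rightarrow> int list \<Rightarrow> bool" where
  "centrally_compressed S i p \<longleftrightarrow>
     {x. insert_coord p x i \<in> S} = {} \<or>
     (\<exists>a::nat. {x. insert_coord p x i \<in> S} = {- int a..int a}) \<or>
     (\<exists>a::nat. {x. insert_coord p x i \<in> S} = {- int a..int a + 1})"

definition downward_compressed :: "int list set \<Rightarrow> nat \<Rightarrow> int list \<Rightarrow> bool" where
  "downward_compressed S j p \<longleftrightarrow>
     {x. 0 \<le> x \<and> insert_coord p x j \<in> S} = {} \<or>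
     (\<exists>a::nat. {x. 0 \<le> x \<and> insert_coord p x j \<in> S} = {0..int a})"

text \<open>\<open>nths x (- I)\<close> keeps the entries of \<open>x\<close> whose index is not in \<open>I\<close>, in order.\<close>

definition proj :: "nat set \<Rightarrow> int list set \<Rightarrow> int list set" where
  "proj I S = (\<lambda>x. nths x (- I)) ` S"

end

theory Submission
  imports Defs
begin

text \<open>
  The nonempty sets allowed as one-dimensional sections are exactly the finite initial segments
  of the order $0, 1, -1, 2, -2, \dots$ on $Z$, respectively $0, 1, 2, \dots$ on $N$. Hence \<open>S\<close>
  is a down-set of the grid for the coordinatewise order (\<open>compressed_down_closed\<close>).

  Among the neighbours of a point \<open>x\<close> there is a least one in this order: it is obtained by
  moving every nonzero coordinate one step towards 0. For a down-set, \<open>x\<close> therefore belongs to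
  the neighbourhood of \<open>S\<close> iff this least neighbour is in \<open>S\<close> (\<open>boundary_eq_retract\<close>). So
  $|\partial S|$ is the sum over \<open>y \<in> S\<close> of the number of grid points that retract to \<open>y\<close>.
  These are counted coordinate by coordinate: a nonzero coordinate of \<open>y\<close> has one preimage,
  a zero coordinate has three in $Z$ (namely $0, 1, -1$) and two in $N$. Writing $3 = 1 + 2$ and
  $2 = 1 + 1$ and expanding the product gives the sum of $2^{|I \cap K|}$ over all sets \<open>I\<close> of
  zero coordinates of \<open>y\<close> (\<open>card_retract_fibre\<close>).

  Exchanging the two sums leaves, for each \<open>I\<close>, the number of points of \<open>S\<close> that vanish on \<open>I\<close>.
  As \<open>S\<close> is a down-set, resetting the coordinates in \<open>I\<close> to 0 stays inside \<open>S\<close>, so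
  these points are in bijection with $P_I(S)$ (\<open>card_proj\<close>).
\<close>

section \<open>The order on one coordinate\<close>

text \<open>
  The initial segment of $0, 1, -1, 2, -2, \dots$ that ends with \<open>y\<close>. For \<open>y \<ge> 0\<close>, its
  nonnegative part is \<open>{0..y}\<close>, so the same segments serve the $N$-coordinates.
\<close>

definition init_seg :: "int \<Rightarrow> int set" where
  "init_seg y = (if y > 0 then {1 - y..y} else {y..- y})"

text \<open>
  The least of \<open>t - 1\<close>, \<open>t\<close>, \<open>t + 1\<close> in the order $0, 1, -1, 2, -2, \dots$: one step towards 0.
\<close>

definition retract :: "int \<Rightarrow> int" where
  "retract t = t - sgn t"

lemma zero_in_init_seg: "0 \<in> init_seg y"
  by (auto simp: init_seg_def)

lemma self_in_init_seg: "y \<in> init_seg y"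
  by (auto simp: init_seg_def)

lemma retract_in_init_seg: "\<bar>x - y\<bar> \<le> 1 \<Longrightarrow> retract x \<in> init_seg y"
  by (auto simp: init_seg_def retract_def sgn_if split: if_splits)

lemma abs_diff_retract: "\<bar>x - retract x\<bar> \<le> 1"
  by (auto simp: retract_def sgn_if)

lemma retract_nonneg: "0 \<le> x \<Longrightarrow> 0 \<le> retract x"
  by (auto simp: retract_def sgn_if)

lemma retract_vimage: "{t. retract t = y} = (if y = 0 then {0, 1, -1} else {y + sgn y})"
  by (auto simp: retract_def sgn_if split: if_splits)

lemma retract_vimage_nonneg:
  "0 \<le> y \<Longrightarrow> {t. retract t = y \<and> 0 \<le> t} = (if y = 0 then {0, 1} else {y + 1})"
  by (auto simp: retract_def sgn_if split: if_splits)

section \<open>Compressed sets are down-sets\<close>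

lemma insert_coord_list_update:
  assumes "i < length y"
  shows "insert_coord (take i y @ drop (Suc i) y) t i = y[i := t]"
  using assms by (simp add: insert_coord_def upd_conv_take_nth_drop)

lemma centrally_compressed_init_seg:
  assumes "centrally_compressed S i p" "insert_coord p y i \<in> S" "x \<in> init_seg y"
  shows "insert_coord p x i \<in> S"
proof -
  define C where "C = {t. insert_coord p t i \<in> S}"
  have "C = {} \<or> (\<exists>a::nat. C = {- int a..int a}) \<or> (\<exists>a::nat. C = {- int a..int a + 1})"
    using assms(1) unfolding centrally_compressed_def C_def .
  moreover have "y \<in> C"
    using assms(2) by (simp add: C_def)
  ultimately have "x \<in> C"
    using assms(3) by (auto simp: init_seg_def split: if_splits)
  then show ?thesis by (simp add: C_def)
qed

lemma downward_compressed_init_seg: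
  assumes "downward_compressed S j p" "insert_coord p y j \<in> S" "0 \<le> y" "x \<in> init_seg y" "0 \<le> x"
  shows "insert_coord p x j \<in> S"
proof -
  define C where "C = {t. 0 \<le> t \<and> insert_coord p t j \<in> S}"
  have "C = {} \<or> (\<exists>a::nat. C = {0..int a})"
    using assms(1) unfolding downward_compressed_def C_def .
  moreover have "y \<in> C"
    using assms(2,3) by (simp add: C_def)
  ultimately have "x \<in> C"
    using assms(4,5) by (auto simp: init_seg_def split: if_splits)
  then show ?thesis by (simp add: C_def)
qed

text \<open>
  The one-coordinate case of down-closedness: the line through \<open>y\<close> in direction \<open>i\<close> meets \<open>S\<close> in
  a section whose base point \<open>p\<close> is \<open>y\<close> without its \<open>i\<close>-th entry.
\<close>

lemma compressed_list_update:
  assumes grid: "S \<subseteq> grid k d"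
    and central: "\<And>i p. i < k \<Longrightarrow> p \<in> grid (k - 1) d \<Longrightarrow> centrally_compressed S i p"
    and downward: "\<And>j p. k \<le> j \<Longrightarrow> j < k + d \<Longrightarrow> p \<in> grid k (d - 1) \<Longrightarrow>
      downward_compressed S j p"
    and y: "y \<in> S" and i: "i < k + d"
    and t: "t \<in> init_seg (y ! i)" "k \<le> i \<Longrightarrow> 0 \<le> t"
  shows "y[i := t] \<in> S"
proof -
  define p where "p = take i y @ drop (Suc i) y"
  have len: "length y = k + d" and nonneg: "\<And>j. k \<le> j \<Longrightarrow> j < k + d \<Longrightarrow> 0 \<le> y ! j"
    using y grid by (auto simp: grid_def)
  have ins: "insert_coord p s i = y[i := s]" for s
    unfolding p_def using i len by (intro insert_coord_list_update) simp
  have y': "insert_coord p (y ! i) i \<in> S"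
    using y by (simp add: ins)
  have lenp: "length p = k + d - 1"
    using i len by (simp add: p_def)
  have pnth: "p ! j = (if j < i then y ! j else y ! Suc j)" if "j < k + d - 1" for j
    using that i len by (auto simp: p_def nth_append min_def)
  show ?thesis
  proof (cases "i < k")
    case True
    then have "0 \<le> p ! j" if "k - 1 \<le> j" "j < k - 1 + d" for j
      using that pnth[of j] nonneg[of "Suc j"] by auto
    then have "p \<in> grid (k - 1) d"
      using lenp True by (simp add: grid_def)
    from centrally_compressed_init_seg[OF central[OF True this] y' t(1)] show ?thesis
      by (simp add: ins)
  next
    case False
    then have "0 \<le> p ! j" if "k \<le> j" "j < k + (d - 1)" for j
      using that i pnth[of j] nonneg[of j] nonneg[of "Suc j"] by simp
    then have "p \<in> grid k (d - 1)"
      using lenp i False by (simp add: grid_def)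
    from downward_compressed_init_seg[OF downward[OF _ i this] y' _ t(1)] show ?thesis
      using False t(2) nonneg[OF _ i] by (simp add: ins)
  qed
qed

definition down_closed :: "nat \<Rightarrow> nat \<Rightarrow> int list set \<Rightarrow> bool" where
  "down_closed k d S \<longleftrightarrow>
     (\<forall>y\<in>S. \<forall>x\<in>grid k d. (\<forall>i<k + d. x ! i \<in> init_seg (y ! i)) \<longrightarrow> x \<in> S)"

text \<open>Replace the coordinates of a point of \<open>S\<close> by smaller ones, one after the other.\<close>

lemma compressed_down_closed:
  assumes grid: "S \<subseteq> grid k d"
    and central: "\<And>i p. i < k \<Longrightarrow> p \<in> grid (k - 1) d \<Longrightarrow> centrally_compressed S i p"
    and downward: "\<And>j p. k \<le> j \<Longrightarrow> j < k + d \<Longrightarrow> p \<in> grid k (d - 1) \<Longrightarrow>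
      downward_compressed S j p"
  shows "down_closed k d S"
  unfolding down_closed_def
proof (intro ballI impI)
  fix y x
  assume y: "y \<in> S" and x: "x \<in> grid k d" and le: "\<forall>i<k + d. x ! i \<in> init_seg (y ! i)"
  have leny: "length y = k + d" and lenx: "length x = k + d"
    and xnonneg: "\<And>j. k \<le> j \<Longrightarrow> j < k + d \<Longrightarrow> 0 \<le> x ! j"
    using y x grid by (auto simp: grid_def)
  have "take m x @ drop m y \<in> S" if "m \<le> k + d" for m
    using that
  proof (induction m)
    case 0
    then show ?case using y by simp
  next
    case (Suc m)
    let ?z = "take m x @ drop m y"
    have z: "?z \<in> S" and m: "m < k + d"
      using Suc by auto
    have "?z ! m = y ! m"
      using m lenx leny by (simp add: nth_append)
    then have "?z[m := x ! m] \<in> S"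
      using compressed_list_update[OF grid central downward z m] le m xnonneg by simp
    moreover have "?z[m := x ! m] = take (Suc m) x @ drop (Suc m) y"
      using m lenx leny
      by (simp add: take_Suc_conv_app_nth list_update_append
          Cons_nth_drop_Suc[symmetric, of m y])
    ultimately show ?case by simp
  qed
  from this[of "k + d"] show "x \<in> S"
    using lenx leny by simp
qed

section \<open>The neighbourhood of a down-set\<close>

lemma linf_norm_vec_diff_le_iff:
  assumes "length x = n" "length y = n" "n > 0"
  shows "linf_norm (vec_diff x y) \<le> c \<longleftrightarrow> (\<forall>i<n. \<bar>x ! i - y ! i\<bar> \<le> c)"
proof -
  have "linf_norm (vec_diff x y) = Max ((\<lambda>i. \<bar>x ! i - y ! i\<bar>) ` {..<n})"
    using assms unfolding linf_norm_def vec_diff_def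
    by (simp cong: image_cong_simp)
  also have "\<dots> \<le> c \<longleftrightarrow> (\<forall>i<n. \<bar>x ! i - y ! i\<bar> \<le> c)"
    using assms(3) by (subst Max_le_iff) auto
  finally show ?thesis .
qed

lemma map_retract_grid: "x \<in> grid k d \<Longrightarrow> map retract x \<in> grid k d"
  by (auto simp: grid_def retract_nonneg)

text \<open>
  The retraction of \<open>x\<close> is itself a neighbour of \<open>x\<close>, and it lies below every other neighbour.
\<close>

lemma boundary_eq_retract:
  assumes pos: "k + d > 0" and grid: "S \<subseteq> grid k d" and down: "down_closed k d S"
  shows "boundary k d S = {x \<in> grid k d. map retract x \<in> S}"
proof -
  have "(\<exists>y\<in>S. linf_norm (vec_diff x y) \<le> 1) \<longleftrightarrow> map retract x \<in> S" if x: "x \<in> grid k d" for x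
  proof
    assume "\<exists>y\<in>S. linf_norm (vec_diff x y) \<le> 1"
    then obtain y where y: "y \<in> S" and near: "linf_norm (vec_diff x y) \<le> 1" by blast
    have len: "length x = k + d" "length y = k + d"
      using x y grid by (auto simp: grid_def)
    have "\<forall>i<k + d. map retract x ! i \<in> init_seg (y ! i)"
      using near len pos by (simp add: linf_norm_vec_diff_le_iff retract_in_init_seg)
    then show "map retract x \<in> S"
      using down y map_retract_grid[OF x] unfolding down_closed_def by blast
  next
    assume retract: "map retract x \<in> S"
    have "length x = k + d"
      using x by (simp add: grid_def)
    then have "linf_norm (vec_diff x (map retract x)) \<le> 1"
      using pos by (subst linf_norm_vec_diff_le_iff) (auto simp: abs_diff_retract)
    with retract show "\<exists>y\<in>S. linf_norm (vec_diff x y) \<le> 1" by blast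
  qed
  then show ?thesis
    unfolding boundary_def by blast
qed

section \<open>Counting the fibres of the retraction\<close>

lemma card_lists_nth_in:
  "card {x :: 'a list. length x = n \<and> (\<forall>i<n. x ! i \<in> A i)} = (\<Prod>i<n. card (A i))"
proof (induction n arbitrary: A)
  case 0
  have "{x :: 'a list. length x = 0 \<and> (\<forall>i<0. x ! i \<in> A i)} = {[]}" by auto
  then show ?case by simp
next
  case (Suc n)
  let ?L = "{x :: 'a list. length x = n \<and> (\<forall>i<n. x ! i \<in> A (Suc i))}"
  have "{x. length x = Suc n \<and> (\<forall>i<Suc n. x ! i \<in> A i)} = (\<lambda>(a, x). a # x) ` (A 0 \<times> ?L)"
  proof (intro equalityI subsetI)
    fix x assume "x \<in> {x. length x = Suc n \<and> (\<forall>i<Suc n. x ! i \<in> A i)}"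
    then show "x \<in> (\<lambda>(a, x). a # x) ` (A 0 \<times> ?L)"
      by (cases x) force+
  next
    fix x assume "x \<in> (\<lambda>(a, x). a # x) ` (A 0 \<times> ?L)"
    then show "x \<in> {x. length x = Suc n \<and> (\<forall>i<Suc n. x ! i \<in> A i)}"
      by (auto simp: nth_Cons split: nat.split)
  qed
  moreover have "inj_on (\<lambda>(a, x). a # x) (A 0 \<times> ?L)"
    by (auto simp: inj_on_def)
  ultimately show ?case
    using Suc.IH[of "\<lambda>i. A (Suc i)"]
    by (simp add: card_image card_cartesian_product prod.lessThan_Suc_shift
        del: prod.lessThan_Suc)
qed

text \<open>
  The fibre is a product of one-coordinate fibres, and a zero coordinate contributes a factor
  $1 + w$ with \<open>w = 2\<close> in $Z$ and \<open>w = 1\<close> in $N$. In the expanded product, \<open>I\<close> stands for the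
  set of coordinates in which the point of the fibre differs from \<open>y\<close> while \<open>y\<close> is 0.
\<close>

lemma card_retract_fibre:
  assumes y: "y \<in> grid k d"
  shows "card {x \<in> grid k d. map retract x = y} =
    (\<Sum>I\<in>Pow {..<k + d}. if \<forall>i\<in>I. y ! i = 0 then 2 ^ card (I \<inter> {..<k}) else 0)"
proof -
  define A where "A i = {t. retract t = y ! i \<and> (k \<le> i \<longrightarrow> 0 \<le> t)}" for i
  \<comment> \<open>The number of nonzero preimages at a zero coordinate.\<close>
  define w :: "nat \<Rightarrow> nat" where "w i = (if i < k then 2 else 1)" for i
  have len: "length y = k + d" and nonneg: "\<And>j. k \<le> j \<Longrightarrow> j < k + d \<Longrightarrow> 0 \<le> y ! j"
    using y by (auto simp: grid_def)
  have "{x \<in> grid k d. map retract x = y} =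
      {x. length x = k + d \<and> (\<forall>i<k + d. x ! i \<in> A i)}"
    using len by (auto simp: grid_def A_def list_eq_iff_nth_eq)
  then have "card {x \<in> grid k d. map retract x = y} = (\<Prod>i<k + d. card (A i))"
    by (simp add: card_lists_nth_in)
  also have "\<dots> = (\<Prod>i<k + d. (if y ! i = 0 then w i else 0) + 1)"
  proof (intro prod.cong refl)
    fix i assume i: "i \<in> {..<k + d}"
    show "card (A i) = (if y ! i = 0 then w i else 0) + 1"
    proof (cases "i < k")
      case True
      then have "A i = {t. retract t = y ! i}"
        by (simp add: A_def)
      with True show ?thesis
        by (simp add: w_def retract_vimage)
    next
      case False
      then have "A i = {t. retract t = y ! i \<and> 0 \<le> t}"
        by (simp add: A_def)
      with False i nonneg[of i] show ?thesis
        by (simp add: w_def retract_vimage_nonneg)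
    qed
  qed
  also have "\<dots> = (\<Sum>I\<in>Pow {..<k + d}. \<Prod>i\<in>I. if y ! i = 0 then w i else 0)"
    by (subst prod_add) simp_all
  also have "\<dots> =
      (\<Sum>I\<in>Pow {..<k + d}. if \<forall>i\<in>I. y ! i = 0 then 2 ^ card (I \<inter> {..<k}) else 0)"
  proof (intro sum.cong refl)
    fix I assume "I \<in> Pow {..<k + d}"
    then have fin: "finite I"
      by (auto intro: finite_subset)
    show "(\<Prod>i\<in>I. if y ! i = 0 then w i else 0) =
        (if \<forall>i\<in>I. y ! i = 0 then 2 ^ card (I \<inter> {..<k}) else 0)"
    proof (cases "\<forall>i\<in>I. y ! i = 0")
      case True
      then have "(\<Prod>i\<in>I. if y ! i = 0 then w i else 0) =
          (\<Prod>i\<in>I. if i \<in> {..<k} then 2 else 1)"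
        by (intro prod.cong) (auto simp: w_def)
      also have "\<dots> = (\<Prod>i\<in>I \<inter> {..<k}. 2)"
        by (rule prod.inter_restrict[OF fin, symmetric])
      finally show ?thesis
        using True by simp
    next
      case False
      with fin show ?thesis
        by (auto simp: prod_zero_iff)
    qed
  qed
  finally show ?thesis .
qed

section \<open>Projections of a down-set\<close>

lemma nths_eq_iff:
  "length x = length y \<Longrightarrow>
    nths x A = nths y A \<longleftrightarrow> (\<forall>i<length x. i \<in> A \<longrightarrow> x ! i = y ! i)"
proof (induction x y arbitrary: A rule: list_induct2)
  case Nil
  then show ?case by simp
next
  case (Cons a x b y)
  then show ?case
    by (auto simp: nths_Cons All_less_Suc2)
qed

text \<open>
  Each point of the projection is represented by exactly one point of \<open>S\<close> that vanishes on \<open>I\<close>: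
  take any preimage and reset its coordinates in \<open>I\<close> to 0, which moves down.
\<close>

lemma card_proj:
  assumes grid: "S \<subseteq> grid k d" and down: "down_closed k d S" and I: "I \<subseteq> {..<k + d}"
  shows "card (proj I S) = card {y \<in> S. \<forall>i\<in>I. y ! i = 0}"
proof -
  let ?T = "{y \<in> S. \<forall>i\<in>I. y ! i = 0}"
  have len: "length y = k + d" if "y \<in> S" for y
    using that grid by (auto simp: grid_def)
  have "inj_on (\<lambda>y. nths y (- I)) ?T"
  proof (rule inj_onI)
    fix x y
    assume x: "x \<in> ?T" and y: "y \<in> ?T" and eq: "nths x (- I) = nths y (- I)"
    have "x ! i = y ! i" if "i < k + d" for i
      using that eq x y len by (cases "i \<in> I") (auto simp: nths_eq_iff)
    then show "x = y"
      using x y len by (auto intro: nth_equalityI)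
  qed
  moreover have "proj I S = (\<lambda>y. nths y (- I)) ` ?T"
  proof (intro equalityI subsetI)
    fix q assume "q \<in> proj I S"
    then obtain y where y: "y \<in> S" and q: "q = nths y (- I)"
      by (auto simp: proj_def)
    define z where "z = map (\<lambda>i. if i \<in> I then 0 else y ! i) [0..<k + d]"
    have znth: "z ! i = (if i \<in> I then 0 else y ! i)" if "i < k + d" for i
      using that by (simp add: z_def del: upt_Suc)
    have lenz: "length z = k + d"
      by (simp add: z_def)
    have "z \<in> grid k d"
      using y grid lenz znth by (auto simp: grid_def)
    moreover have "\<forall>i<k + d. z ! i \<in> init_seg (y ! i)"
      by (simp add: znth zero_in_init_seg self_in_init_seg)
    ultimately have "z \<in> S"
      using down y unfolding down_closed_def by blast
    then have "z \<in> ?T"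
      using I znth by auto
    moreover have "nths z (- I) = q"
      unfolding q using lenz len[OF y] znth by (subst nths_eq_iff) auto
    ultimately show "q \<in> (\<lambda>y. nths y (- I)) ` ?T"
      by blast
  qed (auto simp: proj_def)
  ultimately show ?thesis
    by (simp add: card_image)
qed

section \<open>The size of the neighbourhood\<close>

theorem theorem2:
  fixes k d :: nat and S :: "int list set"
  assumes "\<not> (k = 0 \<and> d = 0)"
    and "S \<subseteq> grid k d"
    and "finite S"
    and "\<And>i p. i < k \<Longrightarrow> p \<in> grid (k - 1) d \<Longrightarrow> centrally_compressed S i p"
    and "\<And>j p. k \<le> j \<Longrightarrow> j < k + d \<Longrightarrow> p \<in> grid k (d - 1) \<Longrightarrow> downward_compressed S j p"
  shows "card (boundary k d S) =
    (\<Sum>I\<in>Pow {..<k + d}. 2 ^ card (I \<inter> {..<k}) * card (proj I S))"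
proof -
  have down: "down_closed k d S"
    using assms(2,4,5) by (rule compressed_down_closed)
  let ?F = "\<lambda>y. {x \<in> grid k d. map retract x = y}"
  let ?c = "\<lambda>I. 2 ^ card (I \<inter> {..<k}) :: nat"
  have "boundary k d S = (\<Union>y\<in>S. ?F y)"
    using boundary_eq_retract[OF _ assms(2) down] assms(1) by auto
  moreover have "finite (?F y)" if "y \<in> S" for y
  proof (rule card_ge_0_finite)
    \<comment> \<open>The empty set contributes 1 to the sum that counts the fibre.\<close>
    have "(\<Sum>I\<in>Pow {..<k + d}. if \<forall>i\<in>I. y ! i = 0 then ?c I else 0) > 0"
      by (rule sum_pos2[of _ "{}"]) auto
    then show "card (?F y) > 0"
      using that assms(2) by (subst card_retract_fibre) auto
  qed
  ultimately have "card (boundary k d S) = (\<Sum>y\<in>S. card (?F y))"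
    using assms(3) by (simp only:) (rule card_UN_disjoint; auto)
  also have "\<dots> =
      (\<Sum>y\<in>S. \<Sum>I\<in>Pow {..<k + d}. if \<forall>i\<in>I. y ! i = 0 then ?c I else 0)"
    using assms(2) by (intro sum.cong refl card_retract_fibre) auto
  also have "\<dots> =
      (\<Sum>I\<in>Pow {..<k + d}. \<Sum>y\<in>S. if \<forall>i\<in>I. y ! i = 0 then ?c I else 0)"
    by (rule sum.swap)
  also have "\<dots> = (\<Sum>I\<in>Pow {..<k + d}. ?c I * card {y \<in> S. \<forall>i\<in>I. y ! i = 0})"
    using assms(3) by (simp add: sum.inter_filter[symmetric] mult.commute)
  also have "\<dots> = (\<Sum>I\<in>Pow {..<k + d}. ?c I * card (proj I S))"
    using card_proj[OF assms(2) down] by (intro sum.cong) auto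
  finally show ?thesis .
qed

end
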